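(* Let $A\subseteq \mathbb{R}^m$, let $a\in A$ and let $V\subseteq \mathbb{R}^m$ be a linear subspace. Let $L\in \mathcal{L}(V,\mathbb{R}^n)$ be a tangential derivative of $f\colon A \to \mathbb{R}^n$ at $a$ with respect to $V$, and let $K\in \mathcal{L}(L[V], \mathbb{R}^p)$ be a tangential derivative of $g\colon f(A) \to \mathbb{R}^p$ at $f(a)$ with respect to $L[V]$. Then the linear map $K\circ L \in \mathcal{L}(V,\mathbb{R}^p)$ is a tangential derivative of $g\circ f$ at $a$ with respect to $V$ if and only if $$\lim_{\substack{v\in V \\ x \to a \\ \frac{\lVert x-a-v\rVert}{\lVert x-a\rVert} \to 0 \\ \frac{\lVert f(x)-f(a)\rVert}{\lVert x-a\rVert} \to 0 }} \frac{\lVert g(f(x))-g(f(a))\rVert}{\lVert x-a\rVert} =0,$$ that is, if and only if for every $\varepsilon>0$ there exist $\delta>0$, $\theta>0$ and $\kappa>0$ such that if $x\in A$, $v\in V$, $\lVert x-a\rVert\le\delta$, $\lVert x-a-v\rVert\le\theta\lVert x-a\rVert$ and $\lVert f(x)-f(a)\rVert\le\kappa\lVert x-a\rVert$, then $\lVert g(f(x))-g(f(a))\rVert\le\varepsilon\lVert x-a\rVert$.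
   Context: $\mathcal{L}(V,\mathbb{R}^n)$ is the space of linear maps from $V$ to $\mathbb{R}^n$, and $L[V]$ is the image of $V$ under $L$. Tangential derivative: let $A\subseteq\mathbb{R}^m$, $a\in A$, $f\colon A\to\mathbb{R}^n$, and let $V\subseteq\mathbb{R}^m$ be a linear subspace. A linear map $L\in\mathcal{L}(V,\mathbb{R}^n)$ is a tangential derivative of $f$ at $a$ with respect to $V$ if for every $\varepsilon>0$ there exist $\delta>0$ and $\theta>0$ such that if $x\in A$, $v\in V$, $\lVert x-a\rVert\le\delta$ and $\lVert x-a-v\rVert\le\theta\lVert x-a\rVert$, then $\lVert f(x)-f(a)-L[v]\rVert\le\varepsilon\lVert x-a\rVert$. (The same definition is applied to $g$ with domain $f(A)\subseteq\mathbb{R}^n$, point $f(a)$ and subspace $L[V]$.) *)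

theory Defs
  imports "HOL-Analysis.Analysis"
begin

text \<open>A map defined on a subset of its type is represented by a total function whose values off
  that subset are unconstrained. Hence linearity of \<open>L \<in> \<L>(V, W)\<close> is required on \<open>V\<close> only.\<close>

definition linear_map_on :: "'a::real_vector set \<Rightarrow> ('a \<Rightarrow> 'b::real_vector) \<Rightarrow> bool" where
  "linear_map_on V L \<longleftrightarrow>
     (\<forall>u\<in>V. \<forall>v\<in>V. L (u + v) = L u + L v) \<and> (\<forall>c. \<forall>v\<in>V. L (c *\<^sub>R v) = c *\<^sub>R L v)"

text \<open>Meant for \<open>a \<in> A\<close> and \<open>V\<close> a linear subspace; only the values of \<open>f\<close> on \<open>A\<close> and of
  \<open>L\<close> on \<open>V\<close> matter.\<close>

definition tangential_derivative ::
  "(real^'m) set \<Rightarrow> (real^'m \<Rightarrow> real^'n) \<Rightarrow> real^'m \<Rightarrow> (real^'m) set \<Rightarrow> (real^'m \<Rightarrow> real^'n) \<Rightarrow> bool"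
where
  "tangential_derivative A f a V L \<longleftrightarrow>
     linear_map_on V L \<and>
     (\<forall>\<epsilon>>0. \<exists>\<delta>>0. \<exists>\<theta>>0. \<forall>x\<in>A. \<forall>v\<in>V.
        norm (x - a) \<le> \<delta> \<longrightarrow> norm (x - a - v) \<le> \<theta> * norm (x - a) \<longrightarrow>
        norm (f x - f a - L v) \<le> \<epsilon> * norm (x - a))"

end

theory Submission
  imports Defs
begin

text \<open>Linear maps on subspaces are bounded, so \<open>L v\<close> is controlled by \<open>x - a\<close>. Where
  \<open>f x - f a\<close> is not small relative to \<open>x - a\<close>, the pair \<open>(f x, L v)\<close> is admissible in the
  definition of the tangential derivative of \<open>g\<close>, and the chain rule holds without any further
  condition. Where it is small, \<open>L v\<close> and hence \<open>K (L v)\<close> are small as well, so that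
  \<open>g (f x) - g (f a) - K (L v)\<close> is small if and only if \<open>g (f x) - g (f a)\<close> is.\<close>

lemma linear_map_on_add:
  "linear_map_on V L \<Longrightarrow> u \<in> V \<Longrightarrow> v \<in> V \<Longrightarrow> L (u + v) = L u + L v"
  by (simp add: linear_map_on_def)

lemma linear_map_on_scaleR:
  "linear_map_on V L \<Longrightarrow> v \<in> V \<Longrightarrow> L (c *\<^sub>R v) = c *\<^sub>R L v"
  by (simp add: linear_map_on_def)

lemma linear_map_on_zero:
  assumes "linear_map_on V L" "subspace V"
  shows "L 0 = 0"
  using linear_map_on_scaleR[OF assms(1) subspace_0[OF assms(2)], of 0] by simp

lemma linear_map_on_sum:
  assumes "linear_map_on V L" "subspace V" "finite I" "\<And>i. i \<in> I \<Longrightarrow> h i \<in> V"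
  shows "L (\<Sum>i\<in>I. h i) = (\<Sum>i\<in>I. L (h i))"
  using assms(3,4)
proof (induction I rule: finite_induct)
  case empty
  then show ?case using linear_map_on_zero[OF assms(1,2)] by simp
next
  case (insert i I)
  then have "(\<Sum>i\<in>I. h i) \<in> V"
    by (intro subspace_sum[OF assms(2)]) auto
  with insert show ?case
    by (simp add: linear_map_on_add[OF assms(1)])
qed

lemma linear_map_on_comp:
  assumes "linear_map_on V L" "linear_map_on (L ` V) K"
  shows "linear_map_on V (K \<circ> L)"
  using assms by (auto simp: linear_map_on_def)

text \<open>Makes the bound for linear maps on subspaces available for \<open>K\<close>, whose
  domain is the image of \<open>V\<close> under \<open>L\<close>.\<close>

lemma subspace_linear_map_on_image:
  assumes "linear_map_on V L" "subspace V"
  shows "subspace (L ` V)"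
  unfolding subspace_def
proof (intro conjI ballI allI)
  show "0 \<in> L ` V"
    using linear_map_on_zero[OF assms] subspace_0[OF assms(2)] by (metis imageI)
next
  fix x y assume "x \<in> L ` V" "y \<in> L ` V"
  then show "x + y \<in> L ` V"
    using linear_map_on_add[OF assms(1)] subspace_add[OF assms(2)] by (smt (verit) image_iff)
next
  fix c x assume "x \<in> L ` V"
  then show "c *\<^sub>R x \<in> L ` V"
    using linear_map_on_scaleR[OF assms(1)] subspace_scale[OF assms(2)] by (smt (verit) image_iff)
qed

text \<open>Linearity is known on \<open>V\<close> only, so the expansion uses an orthonormal basis
  \<open>S\<close> of \<open>V\<close> itself. By Cauchy-Schwarz each coefficient of
  \<open>v\<close> is at most \<open>norm v\<close>, so the sum of the norms of \<open>L b\<close>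
  over \<open>S\<close> bounds \<open>L\<close>.\<close>

lemma linear_map_on_bounded:
  fixes L :: "'a::euclidean_space \<Rightarrow> 'b::real_normed_vector"
  assumes L: "linear_map_on V L" and V: "subspace V"
  obtains B where "B > 0" "\<And>v. v \<in> V \<Longrightarrow> norm (L v) \<le> B * norm v"
proof -
  obtain S where S: "S \<subseteq> V" "pairwise orthogonal S" "\<And>x. x \<in> S \<Longrightarrow> norm x = 1"
      "independent S" "span S = V"
    using orthonormal_basis_subspace[OF V] by metis
  have fin: "finite S"
    using S(4) by (rule independent_imp_finite)
  define B where "B = (\<Sum>b\<in>S. norm (L b))"
  \<comment> \<open>\<open>B\<close> vanishes when \<open>L\<close> is zero on \<open>V\<close>;
    adding 1 makes the constant positive, so that it may later serve as a divisor.\<close>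
  have "norm (L v) \<le> (B + 1) * norm v" if "v \<in> V" for v
  proof -
    have "(\<Sum>b\<in>S. (v \<bullet> b) *\<^sub>R b) = v"
      using S(2,3,5) fin that by (intro orthonormal_basis_expand) auto
    then have "L v = L (\<Sum>b\<in>S. (v \<bullet> b) *\<^sub>R b)"
      by simp
    also have "\<dots> = (\<Sum>b\<in>S. L ((v \<bullet> b) *\<^sub>R b))"
      using S(1) by (intro linear_map_on_sum[OF L V fin]) (auto intro: subspace_scale[OF V])
    also have "\<dots> = (\<Sum>b\<in>S. (v \<bullet> b) *\<^sub>R L b)"
      using S(1) by (intro sum.cong refl linear_map_on_scaleR[OF L]) auto
    also have "norm \<dots> \<le> (\<Sum>b\<in>S. norm v * norm (L b))"
    proof (rule sum_norm_le)
      fix b assume b: "b \<in> S"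
      have "\<bar>v \<bullet> b\<bar> \<le> norm v"
        using Cauchy_Schwarz_ineq2[of v b] S(3)[OF b] by simp
      then show "norm ((v \<bullet> b) *\<^sub>R L b) \<le> norm v * norm (L b)"
        by (simp add: mult_right_mono)
    qed
    also have "\<dots> = B * norm v"
      by (simp add: B_def sum_distrib_left mult.commute)
    also have "\<dots> \<le> (B + 1) * norm v"
      by (simp add: mult_right_mono)
    finally show ?thesis .
  qed
  moreover have "B \<ge> 0"
    unfolding B_def by (simp add: sum_nonneg)
  ultimately show thesis
    using that[of "B + 1"] by simp
qed

lemma tangential_derivativeE:
  assumes "tangential_derivative A f a V L" "\<epsilon> > 0"
  obtains \<delta> \<theta> where "\<delta> > 0" "\<theta> > 0"
    "\<And>x v. x \<in> A \<Longrightarrow> v \<in> V \<Longrightarrow> norm (x - a) \<le> \<delta> \<Longrightarrow> norm (x - a - v) \<le> \<theta> * norm (x - a) \<Longrightarrow>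
       norm (f x - f a - L v) \<le> \<epsilon> * norm (x - a)"
  using assms unfolding tangential_derivative_def by metis

text \<open>Applied with \<open>y\<close> = \<open>f x - f a\<close>, \<open>w\<close> =
  \<open>L v\<close> and \<open>r\<close> = \<open>norm (x - a)\<close>: if \<open>y\<close> is
  small and \<open>w\<close> is close to \<open>y\<close>, then \<open>w\<close> is small. The two
  quarters add up to \<epsilon>/2, which leaves the other half for the remaining term of a triangle
  inequality.\<close>

lemma norm_linear_part_le:
  fixes y w :: "'b::real_normed_vector" and K :: "'b \<Rightarrow> 'c::real_normed_vector"
  assumes "norm (K w) \<le> C * norm w" "C > 0"
    and "norm (y - w) \<le> \<epsilon> / (4 * C) * r" "norm y \<le> \<epsilon> / (4 * C) * r"
  shows "norm (K w) \<le> \<epsilon> / 2 * r"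
proof -
  have "norm w \<le> norm y + norm (y - w)"
    using norm_triangle_ineq4[of y "y - w"] by simp
  also have "\<dots> \<le> \<epsilon> / (2 * C) * r"
    using assms(3,4) by (simp add: field_simps)
  finally have "C * norm w \<le> C * (\<epsilon> / (2 * C) * r)"
    using assms(2) by (intro mult_left_mono) auto
  with assms(1,2) show ?thesis
    by simp
qed

theorem proposition3p1:
  fixes A :: "(real^'m) set" and a :: "real^'m" and V :: "(real^'m) set"
    and f :: "real^'m \<Rightarrow> real^'n" and g :: "real^'n \<Rightarrow> real^'p"
    and L :: "real^'m \<Rightarrow> real^'n" and K :: "real^'n \<Rightarrow> real^'p"
  assumes "a \<in> A"
    and "subspace V"
    and "tangential_derivative A f a V L"
    and "tangential_derivative (f ` A) g (f a) (L ` V) K"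
  shows "tangential_derivative A (g \<circ> f) a V (K \<circ> L) \<longleftrightarrow>
    (\<forall>\<epsilon>>0. \<exists>\<delta>>0. \<exists>\<theta>>0. \<exists>\<kappa>>0. \<forall>x\<in>A. \<forall>v\<in>V.
        norm (x - a) \<le> \<delta> \<longrightarrow> norm (x - a - v) \<le> \<theta> * norm (x - a) \<longrightarrow>
        norm (f x - f a) \<le> \<kappa> * norm (x - a) \<longrightarrow>
        norm (g (f x) - g (f a)) \<le> \<epsilon> * norm (x - a))"
    (is "?chain \<longleftrightarrow> ?lim")
proof -
  have L: "linear_map_on V L" and K: "linear_map_on (L ` V) K"
    using assms(3,4) by (auto simp: tangential_derivative_def)
  obtain B where B: "B > 0" "\<And>v. v \<in> V \<Longrightarrow> norm (L v) \<le> B * norm v"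
    using linear_map_on_bounded[OF L assms(2)] by metis
  obtain C where C: "C > 0" "\<And>w. w \<in> L ` V \<Longrightarrow> norm (K w) \<le> C * norm w"
    using linear_map_on_bounded[OF K subspace_linear_map_on_image[OF L assms(2)]] by metis
  show ?thesis
  proof
    assume chain: ?chain
    show ?lim
    proof (intro allI impI)
      fix \<epsilon> :: real assume \<epsilon>: "\<epsilon> > 0"
      obtain \<delta>1 \<theta>1 where 1: "\<delta>1 > 0" "\<theta>1 > 0"
        "\<And>x v. x \<in> A \<Longrightarrow> v \<in> V \<Longrightarrow> norm (x - a) \<le> \<delta>1 \<Longrightarrow> norm (x - a - v) \<le> \<theta>1 * norm (x - a) \<Longrightarrow>
          norm ((g \<circ> f) x - (g \<circ> f) a - (K \<circ> L) v) \<le> \<epsilon> / 2 * norm (x - a)"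
        using tangential_derivativeE[OF chain, of "\<epsilon> / 2"] \<epsilon> by (metis half_gt_zero)
      \<comment> \<open>This constant has two uses: it is the smallness threshold for
        \<open>f x - f a\<close> in the limit condition, and the accuracy demanded of
        \<open>L\<close>. Together they make \<open>K (L v)\<close> at most \<epsilon>/2 times
        \<open>norm (x - a)\<close>.\<close>
      define \<kappa> where "\<kappa> = \<epsilon> / (4 * C)"
      have \<kappa>: "\<kappa> > 0" using \<epsilon> C(1) by (simp add: \<kappa>_def)
      obtain \<delta>2 \<theta>2 where 2: "\<delta>2 > 0" "\<theta>2 > 0"
        "\<And>x v. x \<in> A \<Longrightarrow> v \<in> V \<Longrightarrow> norm (x - a) \<le> \<delta>2 \<Longrightarrow> norm (x - a - v) \<le> \<theta>2 * norm (x - a) \<Longrightarrow>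
          norm (f x - f a - L v) \<le> \<kappa> * norm (x - a)"
        using tangential_derivativeE[OF assms(3) \<kappa>] by metis
      have "norm (g (f x) - g (f a)) \<le> \<epsilon> * norm (x - a)"
        if x: "x \<in> A" "v \<in> V" "norm (x - a) \<le> min \<delta>1 \<delta>2"
          "norm (x - a - v) \<le> min \<theta>1 \<theta>2 * norm (x - a)"
          "norm (f x - f a) \<le> \<kappa> * norm (x - a)" for x v
      proof -
        have th: "norm (x - a - v) \<le> \<theta>1 * norm (x - a)" "norm (x - a - v) \<le> \<theta>2 * norm (x - a)"
          using x(4) mult_right_mono[of "min \<theta>1 \<theta>2" _ "norm (x - a)"]
          by (meson min.cobounded1 min.cobounded2 norm_ge_zero order_trans)+
        have "norm (K (L v)) \<le> \<epsilon> / 2 * norm (x - a)"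
        proof (rule norm_linear_part_le[OF C(2) C(1)])
          show "L v \<in> L ` V" using x(2) by simp
          show "norm (f x - f a - L v) \<le> \<epsilon> / (4 * C) * norm (x - a)"
            using 2(3)[OF x(1,2) _ th(2)] x(3) by (simp add: \<kappa>_def)
          show "norm (f x - f a) \<le> \<epsilon> / (4 * C) * norm (x - a)"
            using x(5) by (simp add: \<kappa>_def)
        qed
        moreover have "norm (g (f x) - g (f a) - K (L v)) \<le> \<epsilon> / 2 * norm (x - a)"
          using 1(3)[OF x(1,2) _ th(1)] x(3) by simp
        ultimately show ?thesis
          using norm_triangle_ineq[of "g (f x) - g (f a) - K (L v)" "K (L v)"] by simp
      qed
      then show "\<exists>\<delta>>0. \<exists>\<theta>>0. \<exists>\<kappa>>0. \<forall>x\<in>A. \<forall>v\<in>V.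
          norm (x - a) \<le> \<delta> \<longrightarrow> norm (x - a - v) \<le> \<theta> * norm (x - a) \<longrightarrow>
          norm (f x - f a) \<le> \<kappa> * norm (x - a) \<longrightarrow>
          norm (g (f x) - g (f a)) \<le> \<epsilon> * norm (x - a)"
        using 1(1,2) 2(1,2) \<kappa>
        by (intro exI[of _ "min \<delta>1 \<delta>2"] exI[of _ "min \<theta>1 \<theta>2"] exI[of _ \<kappa>] conjI ballI impI) auto
    qed
  next
    assume lim: ?lim
    show ?chain
      unfolding tangential_derivative_def
    proof (intro conjI allI impI)
      show "linear_map_on V (K \<circ> L)"
        using L K by (rule linear_map_on_comp)
    next
      fix \<epsilon> :: real assume \<epsilon>: "\<epsilon> > 0"
      obtain \<delta>1 \<theta>1 \<kappa>1 where 1: "\<delta>1 > 0" "\<theta>1 > 0" "\<kappa>1 > 0"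
        "\<And>x v. x \<in> A \<Longrightarrow> v \<in> V \<Longrightarrow> norm (x - a) \<le> \<delta>1 \<Longrightarrow> norm (x - a - v) \<le> \<theta>1 * norm (x - a) \<Longrightarrow>
          norm (f x - f a) \<le> \<kappa>1 * norm (x - a) \<Longrightarrow>
          norm (g (f x) - g (f a)) \<le> \<epsilon> / 2 * norm (x - a)"
        using lim \<epsilon> by (metis half_gt_zero)
      \<comment> \<open>The threshold of the later case split. Below \<kappa>1 the limit condition
        applies; below \<epsilon>/(4C) the term \<open>K (L v)\<close> is small.\<close>
      define \<kappa> where "\<kappa> = min \<kappa>1 (\<epsilon> / (4 * C))"
      have \<kappa>: "\<kappa> > 0" using 1(3) \<epsilon> C(1) by (simp add: \<kappa>_def)
      \<comment> \<open>\<open>M\<close> will bound \<open>norm (f x - f a)\<close> relative to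
        \<open>norm (x - a)\<close>: 1 for the error of \<open>L\<close>, and 2B for
        \<open>L v\<close>, since \<open>v\<close> is at most twice as long as \<open>x - a\<close>.
        Accuracy \<epsilon>/M for \<open>K\<close> then yields \<epsilon> in the end.\<close>
      define M where "M = 1 + 2 * B"
      have M: "M > 0" using B(1) by (simp add: M_def)
      have "\<epsilon> / M > 0" using \<epsilon> M by simp
      then obtain \<delta>2 \<theta>2 where 2: "\<delta>2 > 0" "\<theta>2 > 0"
        "\<And>y w. y \<in> f ` A \<Longrightarrow> w \<in> L ` V \<Longrightarrow> norm (y - f a) \<le> \<delta>2 \<Longrightarrow>
          norm (y - f a - w) \<le> \<theta>2 * norm (y - f a) \<Longrightarrow>
          norm (g y - g (f a) - K w) \<le> \<epsilon> / M * norm (y - f a)"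
        using tangential_derivativeE[OF assms(4)] by metis
      \<comment> \<open>The entry 1 gives the bound by \<open>M\<close>, the second entry serves the
        case of small \<open>f x - f a\<close>, and the third puts \<open>L v\<close> within the
        cone of aperture \<theta>2 around \<open>f x - f a\<close> in the other case.\<close>
      define \<eta> where "\<eta> = Min {1, \<epsilon> / (4 * C), \<theta>2 * \<kappa>}"
      have \<eta>: "\<eta> > 0" "\<eta> \<le> 1" "\<eta> \<le> \<epsilon> / (4 * C)" "\<eta> \<le> \<theta>2 * \<kappa>"
        using \<epsilon> C(1) 2(2) \<kappa> by (simp_all add: \<eta>_def)
      obtain \<delta>3 \<theta>3 where 3: "\<delta>3 > 0" "\<theta>3 > 0"
        "\<And>x v. x \<in> A \<Longrightarrow> v \<in> V \<Longrightarrow> norm (x - a) \<le> \<delta>3 \<Longrightarrow> norm (x - a - v) \<le> \<theta>3 * norm (x - a) \<Longrightarrow>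
          norm (f x - f a - L v) \<le> \<eta> * norm (x - a)"
        using tangential_derivativeE[OF assms(3) \<eta>(1)] by metis
      \<comment> \<open>Dividing \<delta>2 by \<open>M\<close> keeps \<open>f x\<close> within
        \<delta>2 of \<open>f a\<close>.\<close>
      define \<delta> where "\<delta> = Min {\<delta>1, \<delta>2 / M, \<delta>3}"
      have \<delta>: "\<delta> > 0" "\<delta> \<le> \<delta>1" "\<delta> \<le> \<delta>2 / M" "\<delta> \<le> \<delta>3"
        using 1(1) 2(1) 3(1) M by (simp_all add: \<delta>_def)
      \<comment> \<open>The entry 1 is what yields \<open>norm v \<le> 2 * r\<close>.\<close>
      define \<theta> where "\<theta> = Min {1, \<theta>1, \<theta>3}"
      have \<theta>: "\<theta> > 0" "\<theta> \<le> 1" "\<theta> \<le> \<theta>1" "\<theta> \<le> \<theta>3"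
        using 1(2) 3(2) by (simp_all add: \<theta>_def)
      have "norm ((g \<circ> f) x - (g \<circ> f) a - (K \<circ> L) v) \<le> \<epsilon> * norm (x - a)"
        if x: "x \<in> A" "v \<in> V" "norm (x - a) \<le> \<delta>" "norm (x - a - v) \<le> \<theta> * norm (x - a)" for x v
      proof -
        define r where "r = norm (x - a)"
        have r: "r \<ge> 0" by (simp add: r_def)
        have mono: "p * r \<le> q * r" if "p \<le> q" for p q
          using that r by (rule mult_right_mono)
        have near: "norm (x - a - v) \<le> r" "norm (x - a - v) \<le> \<theta>1 * r" "norm (x - a - v) \<le> \<theta>3 * r"
          using x(4) mono[OF \<theta>(2)] mono[OF \<theta>(3)] mono[OF \<theta>(4)] by (simp_all add: r_def)
        have fL: "norm (f x - f a - L v) \<le> \<eta> * r"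
          using 3(3)[OF x(1,2)] near(3) x(3) \<delta>(4) by (simp add: r_def)
        show ?thesis
        proof (cases "norm (f x - f a) \<le> \<kappa> * r")
          \<comment> \<open>Here \<open>g (f x) - g (f a)\<close> and \<open>K (L v)\<close> are
            estimated separately, each by \<epsilon>/2 times \<open>r\<close>. The point
            \<open>x = a\<close> falls under this case.\<close>
          case True
          have "norm (f x - f a) \<le> \<kappa>1 * r"
            using True mono[of \<kappa> \<kappa>1] by (simp add: \<kappa>_def)
          then have "norm (g (f x) - g (f a)) \<le> \<epsilon> / 2 * r"
            using 1(4)[OF x(1,2)] near(2) x(3) \<delta>(2) by (simp add: r_def)
          moreover have "norm (K (L v)) \<le> \<epsilon> / 2 * r"
          proof (rule norm_linear_part_le[OF C(2) C(1)])
            show "L v \<in> L ` V" using x(2) by simp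
            show "norm (f x - f a - L v) \<le> \<epsilon> / (4 * C) * r"
              using fL mono[OF \<eta>(3)] by linarith
            have "\<kappa> \<le> \<epsilon> / (4 * C)" by (simp add: \<kappa>_def)
            from mono[OF this] True show "norm (f x - f a) \<le> \<epsilon> / (4 * C) * r"
              by linarith
          qed
          ultimately show ?thesis
            using norm_triangle_ineq4[of "g (f x) - g (f a)" "K (L v)"] by (simp add: r_def)
        next
          \<comment> \<open>Here the derivative of \<open>g\<close> is applied at \<open>f x\<close>
            with the vector \<open>L v\<close>, which requires both \<open>f x\<close> near
            \<open>f a\<close> and \<open>L v\<close> close to \<open>f x - f a\<close> relative to
            the latter.\<close>
          case False
          have "norm v \<le> 2 * r"
            using norm_triangle_ineq4[of "x - a" "x - a - v"] near(1) by (simp add: r_def)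
          then have "norm (L v) \<le> B * (2 * r)"
            using B(2)[OF x(2)] B(1) by (meson mult_left_mono less_imp_le order_trans)
          then have fM: "norm (f x - f a) \<le> M * r"
            using norm_triangle_ineq[of "f x - f a - L v" "L v"] fL mono[OF \<eta>(2)]
            by (simp add: M_def algebra_simps)
          also have "\<dots> \<le> \<delta>2"
            using order_trans[OF x(3) \<delta>(3)] M by (simp add: r_def field_simps)
          finally have f\<delta>: "norm (f x - f a) \<le> \<delta>2" .
          \<comment> \<open>The lower bound \<kappa> * r on \<open>norm (f x - f a)\<close> turns an
            error measured against \<open>r\<close> into one measured against
            \<open>norm (f x - f a)\<close>.\<close>
          have "\<eta> * r \<le> \<theta>2 * (\<kappa> * r)"
            using mono[OF \<eta>(4)] by simp
          also have "\<dots> \<le> \<theta>2 * norm (f x - f a)"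
            using False 2(2) by (intro mult_left_mono) auto
          finally have "norm (f x - f a - L v) \<le> \<theta>2 * norm (f x - f a)"
            using fL by linarith
          then have "norm (g (f x) - g (f a) - K (L v)) \<le> \<epsilon> / M * norm (f x - f a)"
            using 2(3)[of "f x" "L v"] x(1,2) f\<delta> by simp
          \<comment> \<open>The upper bound by \<open>M\<close> converts back to
            \<open>r\<close>.\<close>
          also have "\<dots> \<le> \<epsilon> / M * (M * r)"
            using fM \<open>\<epsilon> / M > 0\<close> by (intro mult_left_mono) auto
          also have "\<dots> = \<epsilon> * r"
            using M by simp
          finally show ?thesis by (simp add: r_def)
        qed
      qed
      then show "\<exists>\<delta>>0. \<exists>\<theta>>0. \<forall>x\<in>A. \<forall>v\<in>V.
          norm (x - a) \<le> \<delta> \<longrightarrow> norm (x - a - v) \<le> \<theta> * norm (x - a) \<longrightarrow>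
          norm ((g \<circ> f) x - (g \<circ> f) a - (K \<circ> L) v) \<le> \<epsilon> * norm (x - a)"
        using \<delta>(1) \<theta>(1) by blast
    qed
  qed
qed

end
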